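(* Over finite or infinite nested words, every first-order formula with at most two free variables is equivalent to a first-order formula using at most three distinct variables.
   Context: Let $\Sigma$ be a finite alphabet. A matching on $\mathbb{N}$ or on $[1,n]$ is a binary relation $\mu$ with unary relations $\mathit{call},\mathit{ret}$ such that: (1) $\mu(i,j)$ implies $\mathit{call}(i)$, $\mathit{ret}(j)$, $i<j$; (2) if $\mu(i,j),\mu(i,j')$ then $j=j'$, and if $\mu(i,j),\mu(i',j)$ then $i=i'$; (3) if $i\le j$, $\mathit{call}(i)$, $\mathit{ret}(j)$ then some $k\in[i,j]$ has $\mu(i,k)$ or $\mu(k,j)$. A finite nested word is $(w,\mu,\mathit{call},\mathit{ret})$ with $w\in\Sigma^*$ of length $n$ and a matching on $[1,n]$; a nested $\omega$-word has $w\in\Sigma^\omega$ and a matching on $\mathbb{N}$. Nested words are the structures $\langle U,(P_a)_{a\in\Sigma},<,\mu,\mathit{call},\mathit{ret}\rangle$ ($U=\{1,\dots,n\}$ or $\mathbb{N}$), and first-order formulas are over this vocabulary; equivalence means defining the same relation on every nested word. *)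

theory Defs
  imports Main
begin

definition matching_on ::
  "nat set \<Rightarrow> (nat \<Rightarrow> nat \<Rightarrow> bool) \<Rightarrow> (nat \<Rightarrow> bool) \<Rightarrow> (nat \<Rightarrow> bool) \<Rightarrow> bool" where
  "matching_on U \<mu> call ret \<longleftrightarrow>
     (\<forall>i j. \<mu> i j \<longrightarrow> i \<in> U \<and> j \<in> U) \<and>
     (\<forall>i. call i \<longrightarrow> i \<in> U) \<and>
     (\<forall>i. ret i \<longrightarrow> i \<in> U) \<and>
     (\<forall>i j. \<mu> i j \<longrightarrow> call i \<and> ret j \<and> i < j) \<and>
     (\<forall>i j j'. \<mu> i j \<longrightarrow> \<mu> i j' \<longrightarrow> j = j') \<and>
     (\<forall>i i' j. \<mu> i j \<longrightarrow> \<mu> i' j \<longrightarrow> i = i') \<and>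
     (\<forall>i j. i \<le> j \<longrightarrow> call i \<longrightarrow> ret j \<longrightarrow> (\<exists>k\<in>{i..j}. \<mu> i k \<or> \<mu> k j))"

(* The last three arguments are the relations mu, call and ret. *)
datatype 'a nested_word =
    Fin_NW "'a list" "nat \<Rightarrow> nat \<Rightarrow> bool" "nat \<Rightarrow> bool" "nat \<Rightarrow> bool"
  | Omega_NW "nat \<Rightarrow> 'a" "nat \<Rightarrow> nat \<Rightarrow> bool" "nat \<Rightarrow> bool" "nat \<Rightarrow> bool"

primrec nw_universe :: "'a nested_word \<Rightarrow> nat set" where
  "nw_universe (Fin_NW w \<mu> c r) = {1..length w}"
| "nw_universe (Omega_NW w \<mu> c r) = UNIV"

(* Finite words have positions 1, ..., n; Isabelle lists are indexed from 0. *)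
primrec nw_letter :: "'a nested_word \<Rightarrow> nat \<Rightarrow> 'a" where
  "nw_letter (Fin_NW w \<mu> c r) i = w ! (i - 1)"
| "nw_letter (Omega_NW w \<mu> c r) i = w i"

primrec nw_mu :: "'a nested_word \<Rightarrow> nat \<Rightarrow> nat \<Rightarrow> bool" where
  "nw_mu (Fin_NW w \<mu> c r) = \<mu>"
| "nw_mu (Omega_NW w \<mu> c r) = \<mu>"

primrec nw_call :: "'a nested_word \<Rightarrow> nat \<Rightarrow> bool" where
  "nw_call (Fin_NW w \<mu> c r) = c"
| "nw_call (Omega_NW w \<mu> c r) = c"

primrec nw_ret :: "'a nested_word \<Rightarrow> nat \<Rightarrow> bool" where
  "nw_ret (Fin_NW w \<mu> c r) = r"
| "nw_ret (Omega_NW w \<mu> c r) = r"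

definition nested_word :: "'a nested_word \<Rightarrow> bool" where
  "nested_word N \<longleftrightarrow> matching_on (nw_universe N) (nw_mu N) (nw_call N) (nw_ret N)"

datatype 'a fo =
    Eq nat nat
  | Letter 'a nat
  | Less nat nat
  | Mu nat nat
  | Call nat
  | Ret nat
  | Neg "'a fo"
  | Conj "'a fo" "'a fo"
  | Disj "'a fo" "'a fo"
  | Ex nat "'a fo"
  | All nat "'a fo"

primrec sat :: "'a nested_word \<Rightarrow> (nat \<Rightarrow> nat) \<Rightarrow> 'a fo \<Rightarrow> bool" where
  "sat N \<sigma> (Eq x y) \<longleftrightarrow> \<sigma> x = \<sigma> y"
| "sat N \<sigma> (Letter a x) \<longleftrightarrow> nw_letter N (\<sigma> x) = a"
| "sat N \<sigma> (Less x y) \<longleftrightarrow> \<sigma> x < \<sigma> y"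
| "sat N \<sigma> (Mu x y) \<longleftrightarrow> nw_mu N (\<sigma> x) (\<sigma> y)"
| "sat N \<sigma> (Call x) \<longleftrightarrow> nw_call N (\<sigma> x)"
| "sat N \<sigma> (Ret x) \<longleftrightarrow> nw_ret N (\<sigma> x)"
| "sat N \<sigma> (Neg \<phi>) \<longleftrightarrow> \<not> sat N \<sigma> \<phi>"
| "sat N \<sigma> (Conj \<phi> \<psi>) \<longleftrightarrow> sat N \<sigma> \<phi> \<and> sat N \<sigma> \<psi>"
| "sat N \<sigma> (Disj \<phi> \<psi>) \<longleftrightarrow> sat N \<sigma> \<phi> \<or> sat N \<sigma> \<psi>"
| "sat N \<sigma> (Ex x \<phi>) \<longleftrightarrow> (\<exists>i\<in>nw_universe N. sat N (\<sigma>(x := i)) \<phi>)"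
| "sat N \<sigma> (All x \<phi>) \<longleftrightarrow> (\<forall>i\<in>nw_universe N. sat N (\<sigma>(x := i)) \<phi>)"

primrec free_vars :: "'a fo \<Rightarrow> nat set" where
  "free_vars (Eq x y) = {x, y}"
| "free_vars (Letter a x) = {x}"
| "free_vars (Less x y) = {x, y}"
| "free_vars (Mu x y) = {x, y}"
| "free_vars (Call x) = {x}"
| "free_vars (Ret x) = {x}"
| "free_vars (Neg \<phi>) = free_vars \<phi>"
| "free_vars (Conj \<phi> \<psi>) = free_vars \<phi> \<union> free_vars \<psi>"
| "free_vars (Disj \<phi> \<psi>) = free_vars \<phi> \<union> free_vars \<psi>"
| "free_vars (Ex x \<phi>) = free_vars \<phi> - {x}"
| "free_vars (All x \<phi>) = free_vars \<phi> - {x}"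

primrec all_vars :: "'a fo \<Rightarrow> nat set" where
  "all_vars (Eq x y) = {x, y}"
| "all_vars (Letter a x) = {x}"
| "all_vars (Less x y) = {x, y}"
| "all_vars (Mu x y) = {x, y}"
| "all_vars (Call x) = {x}"
| "all_vars (Ret x) = {x}"
| "all_vars (Neg \<phi>) = all_vars \<phi>"
| "all_vars (Conj \<phi> \<psi>) = all_vars \<phi> \<union> all_vars \<psi>"
| "all_vars (Disj \<phi> \<psi>) = all_vars \<phi> \<union> all_vars \<psi>"
| "all_vars (Ex x \<phi>) = insert x (all_vars \<phi>)"
| "all_vars (All x \<phi>) = insert x (all_vars \<phi>)"

lemma finite_free_vars [simp]: "finite (free_vars \<phi>)"
  by (induction \<phi>) auto

lemma finite_all_vars [simp]: "finite (all_vars \<phi>)"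
  by (induction \<phi>) auto

lemma free_vars_subset_all_vars: "free_vars \<phi> \<subseteq> all_vars \<phi>"
  by (induction \<phi>) auto

(* Only the values of the free variables are required to lie in the universe, so that
   sentences are also compared on the empty word, whose universe is empty. *)
definition fo_equiv :: "'a fo \<Rightarrow> 'a fo \<Rightarrow> bool" where
  "fo_equiv \<phi> \<psi> \<longleftrightarrow>
     (\<forall>N \<sigma>. nested_word N \<longrightarrow>
        (\<forall>x\<in>free_vars \<phi> \<union> free_vars \<psi>. \<sigma> x \<in> nw_universe N) \<longrightarrow>
        (sat N \<sigma> \<phi> \<longleftrightarrow> sat N \<sigma> \<psi>))"

end

theory Submission
  imports Defs
begin

text \<open>The positions of a nested word form a binary tree: the left subtree of a matched call is the
  inside of its edge, and the right subtree of any position consists of what follows it (and its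
  edge) inside the innermost edge around it. Ancestry and sidedness are definable with three
  variables, any two incomparable positions have a meet, and every edge joins a position to its
  right child, so a set of positions closed under meets determines all relations of the vocabulary
  from pairs that are neighbours along branches. In an Ehrenfeucht-Fraisse game on such sets,
  Duplicator only has to preserve the three-variable types of neighbouring pairs: a new position
  either lies between two neighbours, or is a new leaf below some position, or becomes a leaf after
  first inserting its meet with the nearest neighbour.\<close>

section \<open>The binary tree of a nested word\<close>

definition lft :: "'a nested_word \<Rightarrow> nat \<Rightarrow> nat \<Rightarrow> bool" where
  "lft N x y \<longleftrightarrow> (\<exists>r. nw_mu N x r \<and> x < y \<and> y < r)"

text \<open>Only edges that start strictly before x can cut y off. So the return matching x, and
  whatever follows it inside the innermost edge around x, still lies below x.\<close>

definition anc :: "'a nested_word \<Rightarrow> nat \<Rightarrow> nat \<Rightarrow> bool" where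
  "anc N x y \<longleftrightarrow> x < y \<and> (\<forall>c r. nw_mu N c r \<longrightarrow> x < r \<longrightarrow> r \<le> y \<longrightarrow> x \<le> c)"

definition rgt :: "'a nested_word \<Rightarrow> nat \<Rightarrow> nat \<Rightarrow> bool" where
  "rgt N x y \<longleftrightarrow> anc N x y \<and> \<not> lft N x y"

definition is_root :: "'a nested_word \<Rightarrow> nat \<Rightarrow> bool" where
  "is_root N x \<longleftrightarrow> x \<in> nw_universe N \<and> (\<forall>z\<in>nw_universe N. x \<le> z)"

lemma nw_mu_universe: "nested_word N \<Longrightarrow> nw_mu N i j \<Longrightarrow> i \<in> nw_universe N \<and> j \<in> nw_universe N"
  unfolding nested_word_def matching_on_def by blast

lemma nw_mu_less: "nested_word N \<Longrightarrow> nw_mu N i j \<Longrightarrow> i < j"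
  unfolding nested_word_def matching_on_def by blast

lemma nw_mu_fun: "nested_word N \<Longrightarrow> nw_mu N i j \<Longrightarrow> nw_mu N i j' \<Longrightarrow> j = j'"
  unfolding nested_word_def matching_on_def by blast

lemma nw_mu_inj: "nested_word N \<Longrightarrow> nw_mu N i j \<Longrightarrow> nw_mu N i' j \<Longrightarrow> i = i'"
  unfolding nested_word_def matching_on_def by blast

text \<open>Condition (3) on matchings is applied to the call i' and the return j: if j < j', both
  have their only partner outside [i', j].\<close>

lemma nw_mu_noncrossing:
  assumes "nested_word N" "nw_mu N i j" "nw_mu N i' j'" "i < i'" "i' < j"
  shows "j' < j"
proof (rule ccontr)
  assume "\<not> j' < j"
  moreover have "j \<noteq> j'"
    using assms nw_mu_inj by blast
  ultimately have "j < j'"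
    by simp
  have "nw_call N i'" "nw_ret N j"
    using assms unfolding nested_word_def matching_on_def by blast+
  moreover have "\<forall>i j. i \<le> j \<longrightarrow> nw_call N i \<longrightarrow> nw_ret N j \<longrightarrow> (\<exists>k\<in>{i..j}. nw_mu N i k \<or> nw_mu N k j)"
    using assms(1) unfolding nested_word_def matching_on_def by simp
  ultimately obtain k where k: "k \<in> {i'..j}" "nw_mu N i' k \<or> nw_mu N k j"
    using \<open>i' < j\<close> less_imp_le by blast
  then show False
    using assms \<open>j < j'\<close> nw_mu_fun[OF assms(1), of i' k j'] nw_mu_inj[OF assms(1), of k j i] by auto
qed

lemma anc_less: "anc N x y \<Longrightarrow> x < y"
  by (simp add: anc_def)

lemma anc_trans: "anc N x y \<Longrightarrow> anc N y z \<Longrightarrow> anc N x z"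
  unfolding anc_def by (meson dual_order.trans less_imp_le not_le order.strict_trans)

text \<open>For x < y < z, the edges tested for \<open>anc N x y\<close> are among those tested for
  \<open>anc N x z\<close>. So the ancestors of z form a chain.\<close>

lemma anc_linear: "anc N x z \<Longrightarrow> anc N y z \<Longrightarrow> x = y \<or> anc N x y \<or> anc N y x"
  unfolding anc_def by (metis less_imp_le_nat linorder_neqE_nat order_trans)

lemma lft_imp_anc:
  assumes "nested_word N" "lft N x y"
  shows "anc N x y"
proof -
  obtain r where r: "nw_mu N x r" "x < y" "y < r"
    using assms lft_def by blast
  have "x \<le> c" if "nw_mu N c r'" "x < r'" "r' \<le> y" for c r'
    using nw_mu_noncrossing[OF assms(1) that(1) r(1)] that r by linarith
  then show ?thesis
    using r unfolding anc_def by blast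
qed

lemma anc_iff: "nested_word N \<Longrightarrow> anc N x y \<longleftrightarrow> lft N x y \<or> rgt N x y"
  using lft_imp_anc rgt_def by blast

lemma lft_not_rgt: "lft N x y \<Longrightarrow> \<not> rgt N x y"
  by (simp add: rgt_def)

text \<open>If the return of x came at or before z, its edge would start before y and end in (y, z],
  against \<open>anc N y z\<close>.\<close>

lemma lft_anc: "lft N x y \<Longrightarrow> anc N y z \<Longrightarrow> lft N x z"
  unfolding lft_def anc_def by (meson leD leI order.strict_trans)

lemma rgt_anc:
  assumes "nested_word N" "rgt N x y" "anc N y z"
  shows "rgt N x z"
proof -
  have "\<not> lft N x z"
    using assms unfolding rgt_def lft_def anc_def by (metis order.strict_trans)
  then show ?thesis
    using assms anc_trans unfolding rgt_def by blast
qed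

lemma lft_rgt_less: "nested_word N \<Longrightarrow> lft N d x \<Longrightarrow> rgt N d y \<Longrightarrow> x < y"
  unfolding lft_def rgt_def anc_def by (metis leI order_less_le_trans)

text \<open>The failure of \<open>anc\<close> yields an edge around x that closes at or before y.
  The meet is the call of the outermost such edge, the one with the greatest return.\<close>

lemma ex_meet:
  assumes N: "nested_word N" and "x < y" "\<not> anc N x y"
  shows "\<exists>d\<in>nw_universe N. lft N d x \<and> rgt N d y"
proof -
  let ?P = "\<lambda>r. x < r \<and> r \<le> y \<and> (\<exists>c. nw_mu N c r \<and> c < x)"
  have ex: "\<exists>r. ?P r"
    using assms unfolding anc_def by (meson not_le)
  define r where "r = (GREATEST r. ?P r)"
  have r: "?P r"
    unfolding r_def using ex by (rule GreatestI_ex_nat[where b = y]) blast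
  have max: "r' \<le> r" if "?P r'" for r'
    unfolding r_def by (rule Greatest_le_nat[where b = y]) (use that in blast)+
  obtain c where c: "nw_mu N c r" "c < x"
    using r by blast
  have "lft N c x"
    using c r lft_def by blast
  \<comment> \<open>An edge from before c that ends in (c, y] cannot cross the edge from c to r, so
    it closes after r and contradicts the choice of r.\<close>
  have "c \<le> c'" if "nw_mu N c' r'" "c < r'" "r' \<le> y" for c' r'
  proof (rule ccontr)
    assume "\<not> c \<le> c'"
    then have "r < r'"
      using nw_mu_noncrossing[OF N that(1) c(1)] that by simp
    then show False
      using max[of r'] that c r \<open>\<not> c \<le> c'\<close> by (meson leD le_less_trans not_le order.strict_trans)
  qed
  then have "anc N c y"
    using c r unfolding anc_def by auto
  moreover have "\<not> lft N c y"
    using r nw_mu_fun[OF N c(1)] unfolding lft_def by (metis leD)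
  ultimately show ?thesis
    using \<open>lft N c x\<close> nw_mu_universe[OF N c(1)] rgt_def by blast
qed

lemma root_anc:
  assumes "nested_word N" "is_root N \<rho>" "x \<in> nw_universe N" "x \<noteq> \<rho>"
  shows "anc N \<rho> x"
  using assms nw_mu_universe[OF assms(1)] unfolding is_root_def anc_def
  by (metis le_neq_implies_less)

lemma ex_root: "x \<in> nw_universe N \<Longrightarrow> \<exists>\<rho>. is_root N \<rho>"
  unfolding is_root_def
  using LeastI[of "\<lambda>z. z \<in> nw_universe N"] Least_le[of "\<lambda>z. z \<in> nw_universe N"] by blast

lemma mu_rgt:
  assumes N: "nested_word N" and "nw_mu N x y"
  shows "rgt N x y"
proof -
  have "x \<le> c" if "nw_mu N c r" "x < r" "r \<le> y" for c r
    using nw_mu_noncrossing[OF N that(1) assms(2)] nw_mu_inj[OF N that(1), of x] that assms(2)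
    by (metis leD leI order_le_less)
  then show ?thesis
    using assms nw_mu_less[OF N] nw_mu_fun[OF N assms(2)] unfolding rgt_def anc_def lft_def by blast
qed

text \<open>A position below x and before y lies in the left subtree of x, which is closed under
  descendants, whereas y lies in the right one.\<close>

lemma mu_adjacent:
  assumes N: "nested_word N" and "nw_mu N x y" "anc N x z" "anc N z y"
  shows False
proof -
  have "lft N x z"
    using assms anc_less unfolding lft_def by blast
  then show False
    using lft_anc[OF _ assms(4)] mu_rgt[OF N assms(2)] lft_not_rgt by blast
qed

section \<open>Inserting a point into a meet-closed set\<close>

definition meet_closed :: "'a nested_word \<Rightarrow> nat set \<Rightarrow> bool" where
  "meet_closed N S \<longleftrightarrow>
     (\<forall>x\<in>S. \<forall>y\<in>S. x < y \<longrightarrow> anc N x y \<or> (\<exists>d\<in>S. lft N d x \<and> rgt N d y))"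

text \<open>Membership of x and y in S is left open, because the notion is also applied to a point
  that is about to be inserted into S.\<close>

definition adjacent :: "'a nested_word \<Rightarrow> nat set \<Rightarrow> nat \<Rightarrow> nat \<Rightarrow> bool" where
  "adjacent N S x y \<longleftrightarrow> anc N x y \<and> \<not> (\<exists>z\<in>S. anc N x z \<and> anc N z y)"

definition same_side :: "'a nested_word \<Rightarrow> nat \<Rightarrow> nat \<Rightarrow> nat \<Rightarrow> bool" where
  "same_side N p x y \<longleftrightarrow> lft N p x \<and> lft N p y \<or> rgt N p x \<and> rgt N p y"

lemma same_side_anc: "nested_word N \<Longrightarrow> anc N p x \<Longrightarrow> anc N x y \<Longrightarrow> same_side N p x y"
  unfolding same_side_def using anc_iff lft_anc rgt_anc by metis

section \<open>Inserting a point between two neighbours\<close>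

context
  fixes N :: "'a nested_word" and S p q x
  assumes N: "nested_word N" and S: "meet_closed N S" "p \<in> S" "q \<in> S" "adjacent N S p q"
    and x: "anc N p x" "anc N x q"
begin

lemma mid_notin: "x \<notin> S"
  using S x unfolding adjacent_def by blast

lemma mid_above: "z \<in> S \<Longrightarrow> anc N z x \<longleftrightarrow> z = p \<or> anc N z p"
  using S x anc_trans anc_linear unfolding adjacent_def by metis

text \<open>Any other z in S below x would be incomparable to q. Their meet in S cannot lie strictly
  between p and q, so it lies above x, and then z and q are on the same side of it.\<close>

lemma mid_below:
  assumes z: "z \<in> S"
  shows "anc N x z \<longleftrightarrow> z = q \<or> anc N q z"
proof
  assume xz: "anc N x z"
  show "z = q \<or> anc N q z"
  proof (rule ccontr)
    assume a: "\<not> (z = q \<or> anc N q z)"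
    have "\<not> anc N z q"
      using S x xz z anc_trans unfolding adjacent_def by blast
    then obtain d where d: "d \<in> S" "anc N d z" "anc N d q" "\<not> same_side N d z q"
      using a S z N unfolding meet_closed_def same_side_def
      by (metis anc_iff lft_not_rgt linorder_neqE_nat)
    have "d \<noteq> x"
      using d mid_notin by blast
    moreover have "\<not> anc N x d"
      using d S x anc_trans unfolding adjacent_def by blast
    ultimately have "anc N d x"
      using d x anc_linear by blast
    then have "same_side N d x z" "same_side N d x q"
      using N x xz same_side_anc by blast+
    then show False
      using d(4) lft_not_rgt unfolding same_side_def by blast
  qed
qed (use x anc_trans in blast)

lemma mid_lft_above: "z \<in> S \<Longrightarrow> lft N z x \<longleftrightarrow> (z = p \<or> anc N z p) \<and> lft N z q"
  using mid_above lft_anc[OF _ x(2)] rgt_anc[OF N _ x(2)] lft_not_rgt anc_iff[OF N] by metis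

lemma mid_rgt_above: "z \<in> S \<Longrightarrow> rgt N z x \<longleftrightarrow> (z = p \<or> anc N z p) \<and> rgt N z q"
  using mid_above lft_anc[OF _ x(2)] rgt_anc[OF N _ x(2)] lft_not_rgt anc_iff[OF N] by metis

lemma mid_lft_below: "z \<in> S \<Longrightarrow> lft N x z \<longleftrightarrow> (z = q \<or> anc N q z) \<and> lft N x q"
  using mid_below lft_anc rgt_anc[OF N] lft_not_rgt anc_iff[OF N] x by metis

lemma mid_rgt_below: "z \<in> S \<Longrightarrow> rgt N x z \<longleftrightarrow> (z = q \<or> anc N q z) \<and> rgt N x q"
  using mid_below lft_anc rgt_anc[OF N] lft_not_rgt anc_iff[OF N] x by metis

text \<open>No further meet arises: if z in S is incomparable to x, then the meet of q and z is
  already in S and above x, and it also separates x from z.\<close>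

lemma mid_meet_closed: "meet_closed N (insert x S)"
proof -
  have 1: "anc N z x \<or> (\<exists>d\<in>S. lft N d z \<and> rgt N d x)" if z: "z \<in> S" "z < x" for z
  proof (cases "anc N z q")
    case True
    then show ?thesis
      using anc_linear[OF True x(2)] z anc_less by (meson less_irrefl order.strict_trans)
  next
    case False
    then obtain d where d: "d \<in> S" "lft N d z" "rgt N d q"
      using S z anc_less[OF x(2)] unfolding meet_closed_def by (meson order.strict_trans)
    have "d < z"
      using d N anc_less lft_imp_anc by blast
    then have "anc N d x"
      using anc_linear[OF _ x(2), of d] d z N anc_iff anc_less
      by (metis less_irrefl less_trans)
    then show ?thesis
      using d mid_rgt_above mid_above by blast
  qed
  have 2: "anc N x z \<or> (\<exists>d\<in>S. lft N d x \<and> rgt N d z)" if z: "z \<in> S" "x < z" for z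
  proof (rule ccontr)
    assume a: "\<not> ?thesis"
    then have nq: "z \<noteq> q" "\<not> anc N q z"
      using x anc_trans by blast+
    have nzq: "\<not> anc N z q"
      using anc_linear[OF _ x(2), of z] a z anc_less
      by (metis less_irrefl less_trans)
    obtain d where d: "d \<in> S" "lft N d z \<and> rgt N d q \<or> lft N d q \<and> rgt N d z"
      using nq nzq S z unfolding meet_closed_def by (metis linorder_neqE_nat)
    have dd: "anc N d z" "anc N d q"
      using d N anc_iff by blast+
    have "\<not> anc N x d" "d \<noteq> x"
      using a dd anc_trans by blast+
    then have dx: "anc N d x"
      using anc_linear dd x by blast
    show False
      using d(2)
    proof
      assume "lft N d z \<and> rgt N d q"
      then show False
        using lft_rgt_less[OF N, of d z x] mid_rgt_above mid_above d dx z by auto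
    next
      assume "lft N d q \<and> rgt N d z"
      then show False
        using a d dx mid_lft_above mid_above by blast
    qed
  qed
  show ?thesis
    using 1 2 S unfolding meet_closed_def by blast
qed

end

section \<open>Inserting a new leaf\<close>

context
  fixes N :: "'a nested_word" and S p x
  assumes N: "nested_word N" and S: "meet_closed N S" "p \<in> S"
    and x: "anc N p x" "\<And>z. z \<in> S \<Longrightarrow> \<not> same_side N p x z"
begin

lemma leaf_notin: "x \<notin> S"
  using x anc_iff[OF N] unfolding same_side_def by blast

lemma leaf_below: "z \<in> S \<Longrightarrow> \<not> anc N x z"
  using x N same_side_anc by blast

text \<open>An ancestor of x in S that lies strictly below p would be on the same side of p as
  x.\<close>

lemma leaf_above: "z \<in> S \<Longrightarrow> anc N z x \<longleftrightarrow> z = p \<or> anc N z p"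
proof -
  assume z: "z \<in> S"
  have "\<not> anc N p z" if "anc N z x"
    using same_side_anc[OF N _ that, of p] x z unfolding same_side_def by blast
  then show ?thesis
    using anc_linear[OF _ x(1)] anc_trans x(1) by blast
qed

lemma leaf_lft_above: "z \<in> S \<Longrightarrow> lft N z x \<longleftrightarrow> z = p \<and> lft N p x \<or> lft N z p"
  using leaf_above lft_anc[OF _ x(1)] rgt_anc[OF N _ x(1)] lft_not_rgt anc_iff[OF N] by metis

lemma leaf_rgt_above: "z \<in> S \<Longrightarrow> rgt N z x \<longleftrightarrow> z = p \<and> rgt N p x \<or> rgt N z p"
  using leaf_above lft_anc[OF _ x(1)] rgt_anc[OF N _ x(1)] lft_not_rgt anc_iff[OF N] by metis

text \<open>If z lies below p, it lies on the other side than x, and p is the meet. If z is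
  incomparable to p, the meet of p and z also separates x from z.\<close>

lemma leaf_meet_closed: "meet_closed N (insert x S)"
proof -
  have pz: "lft N p x \<and> rgt N p z \<or> rgt N p x \<and> lft N p z" if "z \<in> S" "anc N p z" for z
    using x that anc_iff[OF N] unfolding same_side_def by metis
  have 1: "anc N z x \<or> (\<exists>d\<in>S. lft N d z \<and> rgt N d x)" if z: "z \<in> S" "z < x" for z
  proof (rule ccontr)
    assume a: "\<not> ?thesis"
    then have nz: "z \<noteq> p" "\<not> anc N z p"
      using z leaf_above by blast+
    have "\<not> anc N p z"
      using pz[OF z(1)] a S z lft_rgt_less[OF N, of p x z] by auto
    then obtain d where d: "d \<in> S" "lft N d z \<and> rgt N d p \<or> lft N d p \<and> rgt N d z"
      using nz S z unfolding meet_closed_def by (metis linorder_neqE_nat)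
    then show False
      using a z leaf_rgt_above leaf_lft_above lft_rgt_less[OF N, of d x z] by auto
  qed
  have 2: "anc N x z \<or> (\<exists>d\<in>S. lft N d x \<and> rgt N d z)" if z: "z \<in> S" "x < z" for z
  proof (rule ccontr)
    assume a: "\<not> ?thesis"
    have "p < z"
      using z x anc_less by (meson order.strict_trans)
    have "\<not> anc N p z"
      using pz[OF z(1)] a S z lft_rgt_less[OF N, of p z x] by auto
    then obtain d where d: "d \<in> S" "lft N d p" "rgt N d z"
      using \<open>p < z\<close> S z unfolding meet_closed_def by blast
    then show False
      using a leaf_lft_above by blast
  qed
  show ?thesis
    using 1 2 S unfolding meet_closed_def by blast
qed

end


section \<open>Three-variable definable relations\<close>

type_synonym 'a binrel = "'a nested_word \<Rightarrow> nat \<Rightarrow> nat \<Rightarrow> bool"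

definition defines_rel :: "'a fo \<Rightarrow> nat \<Rightarrow> nat \<Rightarrow> 'a binrel \<Rightarrow> bool" where
  "defines_rel \<psi> x y P \<longleftrightarrow> free_vars \<psi> \<subseteq> {x, y} \<and>
     (\<forall>N \<sigma>. nested_word N \<longrightarrow> \<sigma> x \<in> nw_universe N \<longrightarrow> \<sigma> y \<in> nw_universe N \<longrightarrow>
        (sat N \<sigma> \<psi> \<longleftrightarrow> P N (\<sigma> x) (\<sigma> y)))"

definition fo_definable :: "nat set \<Rightarrow> 'a binrel \<Rightarrow> bool" where
  "fo_definable V P \<longleftrightarrow> (\<forall>x\<in>V. \<forall>y\<in>V. \<exists>\<psi>. all_vars \<psi> \<subseteq> V \<and> defines_rel \<psi> x y P)"

definition rel_comp :: "'a binrel \<Rightarrow> 'a binrel \<Rightarrow> 'a binrel" where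
  "rel_comp P Q = (\<lambda>N a b. \<exists>c\<in>nw_universe N. P N a c \<and> Q N c b)"

definition rel_conv :: "'a binrel \<Rightarrow> 'a binrel" where
  "rel_conv P = (\<lambda>N a b. P N b a)"

lemma fo_definable_cong:
  assumes "fo_definable V P"
    and "\<And>N a b. nested_word N \<Longrightarrow> a \<in> nw_universe N \<Longrightarrow> b \<in> nw_universe N \<Longrightarrow> P N a b \<longleftrightarrow> Q N a b"
  shows "fo_definable V Q"
  using assms unfolding fo_definable_def defines_rel_def by simp

lemma fo_definableI:
  assumes "\<And>x y. x \<in> V \<Longrightarrow> y \<in> V \<Longrightarrow> all_vars (f x y) \<subseteq> V \<and> defines_rel (f x y) x y P"
  shows "fo_definable V P"
  unfolding fo_definable_def using assms by blast

text \<open>Unary predicates become binary relations that ignore their second argument, so that one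
  calculus of relations covers the whole vocabulary.\<close>

lemma fo_definable_atoms:
  "fo_definable V (\<lambda>N a b. a = b)"
  "fo_definable V (\<lambda>N a b. a < b)"
  "fo_definable V nw_mu"
  "fo_definable V (\<lambda>N a b. nw_letter N a = l)"
  "fo_definable V (\<lambda>N a b. nw_call N a)"
  "fo_definable V (\<lambda>N a b. nw_ret N a)"
  "fo_definable V (\<lambda>N a b. True)"
  by (rule fo_definableI[where f = Eq], simp add: defines_rel_def)
    (rule fo_definableI[where f = Less], simp add: defines_rel_def,
     rule fo_definableI[where f = Mu], simp add: defines_rel_def,
     rule fo_definableI[where f = "\<lambda>x y. Letter l x"], simp add: defines_rel_def,
     rule fo_definableI[where f = "\<lambda>x y. Call x"], simp add: defines_rel_def,
     rule fo_definableI[where f = "\<lambda>x y. Ret x"], simp add: defines_rel_def,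
     rule fo_definableI[where f = "\<lambda>x y. Eq x x"], simp add: defines_rel_def)

lemma fo_definable_not:
  assumes "fo_definable V P"
  shows "fo_definable V (\<lambda>N a b. \<not> P N a b)"
proof -
  have "defines_rel (Neg \<psi>) x y (\<lambda>N a b. \<not> P N a b)" if "defines_rel \<psi> x y P" for \<psi> x y
    using that by (simp add: defines_rel_def)
  then show ?thesis
    using assms unfolding fo_definable_def by (metis all_vars.simps(7))
qed

lemma fo_definable_conv:
  assumes "fo_definable V P"
  shows "fo_definable V (rel_conv P)"
proof -
  have "defines_rel \<psi> x y (rel_conv P)" if "defines_rel \<psi> y x P" for \<psi> x y
    using that by (auto simp: defines_rel_def rel_conv_def)
  then show ?thesis
    using assms unfolding fo_definable_def by meson
qed

lemma fo_definable_conj: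
  assumes "fo_definable V P" "fo_definable V Q"
  shows "fo_definable V (\<lambda>N a b. P N a b \<and> Q N a b)"
  unfolding fo_definable_def
proof (intro ballI)
  fix x y
  assume "x \<in> V" "y \<in> V"
  then obtain \<psi> \<chi> where "all_vars \<psi> \<subseteq> V" "defines_rel \<psi> x y P" "all_vars \<chi> \<subseteq> V" "defines_rel \<chi> x y Q"
    using assms unfolding fo_definable_def by meson
  then show "\<exists>\<psi>. all_vars \<psi> \<subseteq> V \<and> defines_rel \<psi> x y (\<lambda>N a b. P N a b \<and> Q N a b)"
    by (intro exI[of _ "Conj \<psi> \<chi>"]) (auto simp: defines_rel_def)
qed

text \<open>Three variables suffice because a composition needs only one variable besides its two
  arguments, and each factor may then reuse the argument that it does not mention.\<close>

lemma fo_definable_comp: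
  assumes V: "card V = 3" and PQ: "fo_definable V P" "fo_definable V Q"
  shows "fo_definable V (rel_comp P Q)"
  unfolding fo_definable_def
proof (intro ballI)
  fix x y
  assume xy: "x \<in> V" "y \<in> V"
  have "\<not> V \<subseteq> {x, y}"
    using V card_mono[of "{x, y}" V] card_insert_le_m1[of 2 "{y}" x] by auto
  then obtain z where z: "z \<in> V" "z \<noteq> x" "z \<noteq> y"
    by blast
  obtain \<psi> \<chi> where "all_vars \<psi> \<subseteq> V" "defines_rel \<psi> x z P" "all_vars \<chi> \<subseteq> V" "defines_rel \<chi> z y Q"
    using PQ xy z unfolding fo_definable_def by meson
  then show "\<exists>\<psi>. all_vars \<psi> \<subseteq> V \<and> defines_rel \<psi> x y (rel_comp P Q)"
    using z by (intro exI[of _ "Ex z (Conj \<psi> \<chi>)"]) (auto simp: defines_rel_def rel_comp_def)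
qed

lemma fo_definable_ball:
  assumes "finite F" "\<And>R. R \<in> F \<Longrightarrow> fo_definable V (P R)"
  shows "fo_definable V (\<lambda>N a b. \<forall>R\<in>F. P R N a b)"
  using assms
proof (induction F rule: finite_induct)
  case empty
  show ?case
    using fo_definable_atoms(7) by simp
next
  case (insert R F)
  then show ?case
    using fo_definable_conj[of V "P R" "\<lambda>N a b. \<forall>R\<in>F. P R N a b"] by simp
qed

lemma fo_definable_bex:
  assumes "finite F" "\<And>R. R \<in> F \<Longrightarrow> fo_definable V (P R)"
  shows "fo_definable V (\<lambda>N a b. \<exists>R\<in>F. P R N a b)"
  using fo_definable_not[OF fo_definable_ball[OF assms(1) fo_definable_not[OF assms(2)]]] by simp

lemma fo_definable_lft:
  assumes "card V = 3"
  shows "fo_definable V lft"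
  by (rule fo_definable_cong[OF fo_definable_conj[OF fo_definable_atoms(2)
        fo_definable_comp[OF assms fo_definable_atoms(3) fo_definable_conv[OF fo_definable_atoms(2)]]]])
    (auto simp: lft_def rel_comp_def rel_conv_def dest: nw_mu_universe)

lemma fo_definable_anc:
  assumes "card V = 3"
  shows "fo_definable V anc"
proof -
  note less = fo_definable_atoms(2)[of V] and gr = fo_definable_conv[OF fo_definable_atoms(2)[of V]]
  \<comment> \<open>\<open>enter\<close> relates a to every return b > a whose call precedes a. Then
    \<open>anc\<close> says that no such return occurs at or before the second argument.\<close>
  note enter = fo_definable_conj[OF less fo_definable_comp[OF assms gr fo_definable_atoms(3)]]
  show ?thesis
    by (rule fo_definable_cong[OF fo_definable_conj[OF less fo_definable_not[OF
            fo_definable_comp[OF assms enter fo_definable_not[OF gr]]]]])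
      (auto simp: anc_def rel_comp_def rel_conv_def not_less not_le dest: nw_mu_universe;
        meson nw_mu_universe leD leI)
qed

lemma fo_definable_rgt: "card V = 3 \<Longrightarrow> fo_definable V rgt"
  unfolding rgt_def[abs_def]
  by (intro fo_definable_conj fo_definable_not fo_definable_anc fo_definable_lft)

lemma fo_definable_is_root:
  assumes "card V = 3"
  shows "fo_definable V (\<lambda>N a b. is_root N a)"
  by (rule fo_definable_cong[OF fo_definable_not[OF fo_definable_comp[OF assms
          fo_definable_conv[OF fo_definable_atoms(2)] fo_definable_atoms(7)]]])
    (auto simp: is_root_def rel_comp_def rel_conv_def not_less)

text \<open>For A \<subseteq> F this is a complete type over F: it also records which relations of F
  fail at the pair.\<close>

definition pattern :: "'a binrel set \<Rightarrow> 'a binrel set \<Rightarrow> 'a binrel" where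
  "pattern F A = (\<lambda>N a b. \<forall>R\<in>F. R N a b \<longleftrightarrow> R \<in> A)"

definition conv_closure :: "'a binrel set \<Rightarrow> 'a binrel set" where
  "conv_closure F = F \<union> rel_conv ` F"

text \<open>Two pairs agree on \<open>rels m\<close> if they are indistinguishable by \<open>m\<close> rounds of the game with three
  pebbles, starting from the tree relations as atoms.\<close>

primrec rels :: "nat \<Rightarrow> 'a binrel set" where
  "rels 0 = conv_closure ({\<lambda>N a b. a = b, nw_mu, lft, rgt, \<lambda>N a b. is_root N a,
      \<lambda>N a b. nw_call N a, \<lambda>N a b. nw_ret N a} \<union> range (\<lambda>l N a b. nw_letter N a = l))"
| "rels (Suc m) = conv_closure (rels m \<union>
      (\<lambda>(A, B). rel_comp (pattern (rels m) A) (pattern (rels m) B)) ` (Pow (rels m) \<times> Pow (rels m)))"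

text \<open>The base case rests on the finite alphabet, the step on there being finitely many types
  over a finite family.\<close>

lemma finite_rels: "finite (rels m :: 'a::finite binrel set)"
  by (induction m) (auto simp: conv_closure_def)

lemma conv_rels: "R \<in> rels m \<Longrightarrow> rel_conv R \<in> rels m"
proof -
  have "rel_conv R \<in> conv_closure F" if "R \<in> conv_closure F" for F
    using that by (auto simp: conv_closure_def rel_conv_def)
  then show "R \<in> rels m \<Longrightarrow> rel_conv R \<in> rels m"
    by (cases m) (simp_all only: rels.simps)
qed

lemma rels_mono: "m \<le> n \<Longrightarrow> rels m \<subseteq> rels n"
  by (rule lift_Suc_mono_le[of rels]) (auto simp: conv_closure_def)

lemma fo_definable_pattern:
  assumes "finite F" "\<And>R. R \<in> F \<Longrightarrow> fo_definable V R"
  shows "fo_definable V (pattern F A)"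
  unfolding pattern_def
proof (rule fo_definable_ball[OF assms(1)])
  fix R
  assume "R \<in> F"
  then show "fo_definable V (\<lambda>N a b. R N a b \<longleftrightarrow> R \<in> A)"
    using assms(2) fo_definable_not by (cases "R \<in> A") auto
qed

lemma fo_definable_rels:
  fixes R :: "'a::finite binrel"
  assumes "card V = 3"
  shows "R \<in> rels m \<Longrightarrow> fo_definable V R"
proof (induction m arbitrary: R)
  case 0
  then show ?case
    using fo_definable_atoms fo_definable_lft fo_definable_rgt fo_definable_is_root assms
    by (auto simp: conv_closure_def intro!: fo_definable_conv)
next
  case (Suc m)
  have "fo_definable V (pattern (rels m :: 'a binrel set) A)" for A
    by (rule fo_definable_pattern[OF finite_rels Suc.IH])
  then show ?case
    using Suc by (auto simp: conv_closure_def intro!: fo_definable_conv fo_definable_comp[OF assms])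
qed

section \<open>The back-and-forth argument\<close>

definition eqv :: "nat \<Rightarrow> 'a nested_word \<Rightarrow> nat \<Rightarrow> nat \<Rightarrow> 'a nested_word \<Rightarrow> nat \<Rightarrow> nat \<Rightarrow> bool" where
  "eqv m N a b N' a' b' \<longleftrightarrow> (\<forall>R\<in>rels m. R N a b \<longleftrightarrow> R N' a' b')"

lemma eqv_sym: "eqv m N a b N' a' b' \<Longrightarrow> eqv m N' a' b' N a b"
  unfolding eqv_def by blast

lemma eqv_swap:
  assumes "eqv m N a b N' a' b'"
  shows "eqv m N b a N' b' a'"
  unfolding eqv_def
proof
  fix R :: "'a binrel"
  assume "R \<in> rels m"
  then have "rel_conv R N a b \<longleftrightarrow> rel_conv R N' a' b'"
    using assms conv_rels unfolding eqv_def by blast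
  then show "R N b a \<longleftrightarrow> R N' b' a'"
    by (simp add: rel_conv_def)
qed

lemma eqv_mono: "eqv n N a b N' a' b' \<Longrightarrow> m \<le> n \<Longrightarrow> eqv m N a b N' a' b'"
  unfolding eqv_def using rels_mono by blast

lemma eqv_rels_0: "eqv m N a b N' a' b' \<Longrightarrow> R \<in> rels 0 \<Longrightarrow> R N a b \<longleftrightarrow> R N' a' b'"
  unfolding eqv_def using rels_mono[of 0 m] by blast

lemma eqv_atoms:
  assumes "eqv m N a b N' a' b'"
  shows "a = b \<longleftrightarrow> a' = b'" "nw_mu N a b \<longleftrightarrow> nw_mu N' a' b'" "lft N a b \<longleftrightarrow> lft N' a' b'"
    "rgt N a b \<longleftrightarrow> rgt N' a' b'" "is_root N a \<longleftrightarrow> is_root N' a'" "nw_call N a \<longleftrightarrow> nw_call N' a'"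
    "nw_ret N a \<longleftrightarrow> nw_ret N' a'" "nw_letter N a = l \<longleftrightarrow> nw_letter N' a' = l"
  by (rule eqv_rels_0[OF assms], simp add: conv_closure_def)+

lemma eqv_anc:
  assumes "nested_word N" "nested_word N'" "eqv m N a b N' a' b'"
  shows "anc N a b \<longleftrightarrow> anc N' a' b'"
  using assms eqv_atoms(3,4)[OF assms(3)] anc_iff by blast

text \<open>One round of the game. With A and B the types of (a, c) and (c, b), the composition of
  the two patterns belongs to the next family, so its truth at (a', b') supplies the answer
  c'.\<close>

lemma eqv_step:
  assumes e: "eqv (Suc m) N a b N' a' b'" and c: "c \<in> nw_universe N"
  shows "\<exists>c'\<in>nw_universe N'. eqv m N a c N' a' c' \<and> eqv m N c b N' c' b'"
proof -
  define A B where "A = {R \<in> rels m. R N a c}" and "B = {R \<in> rels m. R N c b}"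
  let ?R = "rel_comp (pattern (rels m) A) (pattern (rels m) B)"
  have "?R \<in> rels (Suc m)"
    by (auto simp: A_def B_def conv_closure_def)
  moreover have "?R N a b"
    using c by (auto simp: rel_comp_def pattern_def A_def B_def)
  ultimately have "?R N' a' b'"
    using e unfolding eqv_def by blast
  then show ?thesis
    by (auto simp: rel_comp_def pattern_def A_def B_def eqv_def)
qed

text \<open>The round in which c is a itself: equality is among the relations, so the answer has to
  be a'.\<close>

lemma eqv_diag:
  assumes "eqv n N a b N' a' b'" "a \<in> nw_universe N" "m < n"
  shows "eqv m N a a N' a' a'"
proof -
  have "eqv (Suc m) N a b N' a' b'"
    using eqv_mono assms by (metis Suc_leI)
  then obtain c' where "eqv m N a a N' a' c'"
    using eqv_step[OF _ assms(2)] by blast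
  then show ?thesis
    using eqv_atoms(1) by metis
qed

text \<open>Depth m is required only of single points and of neighbouring pairs; all other pairs
  must agree on the tree relations alone. The root guarantees that every new position has an
  ancestor in the domain.\<close>

definition partial_iso ::
  "nat \<Rightarrow> 'a nested_word \<Rightarrow> 'a nested_word \<Rightarrow> (nat \<times> nat) set \<Rightarrow> bool" where
  "partial_iso m N N' Z \<longleftrightarrow> Z \<subseteq> nw_universe N \<times> nw_universe N' \<and>
     (\<exists>\<rho> \<rho>'. (\<rho>, \<rho>') \<in> Z \<and> is_root N \<rho> \<and> is_root N' \<rho>') \<and> meet_closed N (Domain Z) \<and>
     (\<forall>x x' y y'. (x, x') \<in> Z \<longrightarrow> (y, y') \<in> Z \<longrightarrow> (x = y \<longleftrightarrow> x' = y') \<and>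
        (lft N x y \<longleftrightarrow> lft N' x' y') \<and> (rgt N x y \<longleftrightarrow> rgt N' x' y')) \<and>
     (\<forall>x x'. (x, x') \<in> Z \<longrightarrow> eqv m N x x N' x' x') \<and>
     (\<forall>x x' y y'. (x, x') \<in> Z \<longrightarrow> (y, y') \<in> Z \<longrightarrow> adjacent N (Domain Z) x y \<longrightarrow>
        eqv m N x y N' x' y')"

lemma partial_iso_mono: "partial_iso n N N' Z \<Longrightarrow> m \<le> n \<Longrightarrow> partial_iso m N N' Z"
  unfolding partial_iso_def using eqv_mono by meson

context
  fixes m N N' Z
  assumes N: "nested_word N" "nested_word N'" and Z: "partial_iso m N N' Z"
begin

lemma partial_iso_universe: "(x, x') \<in> Z \<Longrightarrow> x \<in> nw_universe N \<and> x' \<in> nw_universe N'"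
  using Z unfolding partial_iso_def by blast

lemma partial_iso_root: "\<exists>\<rho> \<rho>'. (\<rho>, \<rho>') \<in> Z \<and> is_root N \<rho> \<and> is_root N' \<rho>'"
  using Z unfolding partial_iso_def by blast

lemma partial_iso_meet_closed: "meet_closed N (Domain Z)"
  using Z unfolding partial_iso_def by blast

lemma partial_iso_eqv: "(x, x') \<in> Z \<Longrightarrow> eqv m N x x N' x' x'"
  using Z unfolding partial_iso_def by blast

lemma partial_iso_eqv_adjacent:
  "(x, x') \<in> Z \<Longrightarrow> (y, y') \<in> Z \<Longrightarrow> adjacent N (Domain Z) x y \<Longrightarrow> eqv m N x y N' x' y'"
  using Z unfolding partial_iso_def by blast

context
  fixes x x' y y'
  assumes xy: "(x, x') \<in> Z" "(y, y') \<in> Z"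
begin

lemma partial_iso_eq: "x = y \<longleftrightarrow> x' = y'"
  using Z xy unfolding partial_iso_def by blast

lemma partial_iso_lft: "lft N x y \<longleftrightarrow> lft N' x' y'"
  using Z xy unfolding partial_iso_def by blast

lemma partial_iso_rgt: "rgt N x y \<longleftrightarrow> rgt N' x' y'"
  using Z xy unfolding partial_iso_def by blast

lemma partial_iso_anc: "anc N x y \<longleftrightarrow> anc N' x' y'"
  using partial_iso_lft partial_iso_rgt anc_iff N by blast

end

lemma partial_iso_less_imp:
  assumes "(x, x') \<in> Z" "(y, y') \<in> Z" "x < y"
  shows "anc N' x' y' \<or> (\<exists>d\<in>Range Z. lft N' d x' \<and> rgt N' d y')"
  using partial_iso_meet_closed assms partial_iso_anc[OF assms(1,2)]
    partial_iso_lft[OF _ assms(1)] partial_iso_rgt[OF _ assms(2)]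
  unfolding meet_closed_def by (meson DomainE DomainI RangeI)

text \<open>The order is recovered from the tree: x < y means that x is an ancestor of y or that x
  is to the left of y below their meet. The meet lies in the domain, so it is carried over;
  trichotomy gives the converse.\<close>

lemma partial_iso_less:
  assumes "(x, x') \<in> Z" "(y, y') \<in> Z"
  shows "x < y \<longleftrightarrow> x' < y'"
  using partial_iso_less_imp[OF assms] partial_iso_less_imp[OF assms(2,1)]
    partial_iso_eq[OF assms] anc_less lft_rgt_less[OF N(2)] by (metis linorder_neqE_nat less_asym)

text \<open>This makes partial isomorphisms symmetric, so that the back moves reduce to the forth
  moves.\<close>

lemma partial_iso_meet_closed': "meet_closed N' (Range Z)"
  unfolding meet_closed_def using partial_iso_less_imp partial_iso_less by (meson RangeE)

lemma partial_iso_adjacent: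
  assumes "(x, x') \<in> Z" "(y, y') \<in> Z"
  shows "adjacent N (Domain Z) x y \<longleftrightarrow> adjacent N' (Range Z) x' y'"
  unfolding adjacent_def using assms partial_iso_anc by (metis Domain.cases Domain.intros Range.cases Range.intros)

lemma partial_iso_converse: "partial_iso m N' N (Z\<inverse>)"
  using partial_iso_universe partial_iso_root partial_iso_meet_closed' partial_iso_eq
    partial_iso_lft partial_iso_rgt partial_iso_eqv[THEN eqv_sym]
    partial_iso_eqv_adjacent[THEN eqv_sym] partial_iso_adjacent
  unfolding partial_iso_def by auto

text \<open>A new point can only destroy adjacency among the old ones, so depth m has to be checked
  only for pairs that contain x.\<close>

lemma partial_iso_insert:
  assumes x: "x \<in> nw_universe N" "x' \<in> nw_universe N'" "eqv m N x x N' x' x'"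
    and closed: "meet_closed N (insert x (Domain Z))"
    and new: "x \<notin> Domain Z" "x' \<notin> Range Z"
    and rel: "\<And>z z'. (z, z') \<in> Z \<Longrightarrow> (lft N z x \<longleftrightarrow> lft N' z' x') \<and> (rgt N z x \<longleftrightarrow> rgt N' z' x') \<and>
        (lft N x z \<longleftrightarrow> lft N' x' z') \<and> (rgt N x z \<longleftrightarrow> rgt N' x' z')"
    and adj: "\<And>z z'. (z, z') \<in> Z \<Longrightarrow> adjacent N (Domain Z) z x \<Longrightarrow> eqv m N z x N' z' x'"
      "\<And>z z'. (z, z') \<in> Z \<Longrightarrow> adjacent N (Domain Z) x z \<Longrightarrow> eqv m N x z N' x' z'"
  shows "partial_iso m N N' (insert (x, x') Z)"
proof -
  have irrefl: "\<not> lft M u u" "\<not> rgt M u u" for M :: "'a nested_word" and u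
    by (auto simp: lft_def rgt_def anc_def)
  have adj': "adjacent N (Domain Z) u v" if "adjacent N (insert x (Domain Z)) u v" for u v
    using that by (auto simp: adjacent_def)
  have nadj: "\<not> adjacent N (insert x (Domain Z)) x x"
    using anc_less by (auto simp: adjacent_def)
  have ne: "z \<noteq> x \<and> z' \<noteq> x'" if "(z, z') \<in> Z" for z z'
    using new that by blast
  have "\<forall>u u' v v'. (u, u') \<in> insert (x, x') Z \<longrightarrow> (v, v') \<in> insert (x, x') Z \<longrightarrow>
      (u = v \<longleftrightarrow> u' = v') \<and> (lft N u v \<longleftrightarrow> lft N' u' v') \<and> (rgt N u v \<longleftrightarrow> rgt N' u' v')"
  proof (intro allI impI)
    fix u u' v v'
    assume "(u, u') \<in> insert (x, x') Z" "(v, v') \<in> insert (x, x') Z"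
    then show "(u = v \<longleftrightarrow> u' = v') \<and> (lft N u v \<longleftrightarrow> lft N' u' v') \<and> (rgt N u v \<longleftrightarrow> rgt N' u' v')"
      using ne[of u u'] ne[of v v'] rel[of u u'] rel[of v v'] irrefl
        partial_iso_eq[of u u' v v'] partial_iso_lft[of u u' v v'] partial_iso_rgt[of u u' v v']
      unfolding insert_iff prod.inject by metis
  qed
  moreover have "\<forall>u u' v v'. (u, u') \<in> insert (x, x') Z \<longrightarrow> (v, v') \<in> insert (x, x') Z \<longrightarrow>
      adjacent N (Domain (insert (x, x') Z)) u v \<longrightarrow> eqv m N u v N' u' v'"
  proof (intro allI impI)
    fix u u' v v'
    assume "(u, u') \<in> insert (x, x') Z" "(v, v') \<in> insert (x, x') Z"
      "adjacent N (Domain (insert (x, x') Z)) u v"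
    then show "eqv m N u v N' u' v'"
      using nadj adj(1)[of u u'] adj(2)[of v v'] adj'[of u v] partial_iso_eqv_adjacent[of u u' v v']
      unfolding insert_iff prod.inject Domain_insert by metis
  qed
  moreover have "\<forall>u u'. (u, u') \<in> insert (x, x') Z \<longrightarrow> eqv m N u u N' u' u'"
    using x(3) partial_iso_eqv by blast
  moreover have "insert (x, x') Z \<subseteq> nw_universe N \<times> nw_universe N'"
    using x partial_iso_universe by auto
  moreover have "meet_closed N (Domain (insert (x, x') Z))"
    using closed by simp
  moreover have "\<exists>\<rho> \<rho>'. (\<rho>, \<rho>') \<in> insert (x, x') Z \<and> is_root N \<rho> \<and> is_root N' \<rho>'"
    using partial_iso_root by blast
  ultimately show ?thesis
    unfolding partial_iso_def by (intro conjI)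
qed

lemma partial_iso_insert_mid:
  assumes pq: "(p, p') \<in> Z" "(q, q') \<in> Z" "adjacent N (Domain Z) p q"
    and x: "x \<in> nw_universe N" "x' \<in> nw_universe N'" "anc N p x" "anc N x q"
    and e: "eqv m N p x N' p' x'" "eqv m N x q N' x' q'" "eqv m N x x N' x' x'"
  shows "partial_iso m N N' (insert (x, x') Z)"
proof -
  have p': "adjacent N' (Range Z) p' q'" "anc N' p' x'" "anc N' x' q'"
    using partial_iso_adjacent pq x eqv_anc[OF N] e by blast+
  \<comment> \<open>The insertion facts are used in both words. They describe x over
    \<open>Domain Z\<close> and x' over \<open>Range Z\<close> by the same Boolean combinations of
    relations to p, q and p', q', so the two descriptions agree.\<close>
  note 1 = N(1) partial_iso_meet_closed DomainI[OF pq(1)] DomainI[OF pq(2)] pq(3) x(3,4)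
  note 2 = N(2) partial_iso_meet_closed' RangeI[OF pq(1)] RangeI[OF pq(2)] p'
  show ?thesis
  proof (rule partial_iso_insert)
    show "meet_closed N (insert x (Domain Z))" "x \<notin> Domain Z" "x' \<notin> Range Z"
      using mid_meet_closed[OF 1] mid_notin[OF 1] mid_notin[OF 2] by blast+
    fix z z'
    assume z: "(z, z') \<in> Z"
    note tr = partial_iso_eq[OF z pq(1)] partial_iso_eq[OF z pq(2)] partial_iso_anc[OF z pq(1)]
      partial_iso_anc[OF pq(2) z] partial_iso_lft[OF z pq(2)] partial_iso_rgt[OF z pq(2)]
      eqv_atoms(3,4)[OF e(2)]
    show "(lft N z x \<longleftrightarrow> lft N' z' x') \<and> (rgt N z x \<longleftrightarrow> rgt N' z' x') \<and>
        (lft N x z \<longleftrightarrow> lft N' x' z') \<and> (rgt N x z \<longleftrightarrow> rgt N' x' z')"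
      using mid_lft_above[OF 1 DomainI[OF z]] mid_rgt_above[OF 1 DomainI[OF z]]
        mid_lft_below[OF 1 DomainI[OF z]] mid_rgt_below[OF 1 DomainI[OF z]]
        mid_lft_above[OF 2 RangeI[OF z]] mid_rgt_above[OF 2 RangeI[OF z]]
        mid_lft_below[OF 2 RangeI[OF z]] mid_rgt_below[OF 2 RangeI[OF z]] tr
      by argo
    show "eqv m N z x N' z' x'" if "adjacent N (Domain Z) z x"
    proof -
      have "z = p"
        using that mid_above[OF 1 DomainI[OF z]] pq x unfolding adjacent_def by blast
      then show ?thesis
        using e tr by blast
    qed
    show "eqv m N x z N' x' z'" if "adjacent N (Domain Z) x z"
    proof -
      have "z = q"
        using that mid_below[OF 1 DomainI[OF z]] pq x unfolding adjacent_def by blast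
      then show ?thesis
        using e tr by blast
    qed
  qed (use x e in auto)
qed

text \<open>The leaf x has p as its only neighbour, so one pair is all that has to agree besides x
  itself.\<close>

lemma partial_iso_insert_leaf:
  assumes p: "(p, p') \<in> Z"
    and x: "x \<in> nw_universe N" "x' \<in> nw_universe N'" "anc N p x"
      "\<And>z. z \<in> Domain Z \<Longrightarrow> \<not> same_side N p x z"
    and e: "eqv m N p x N' p' x'" "eqv m N x x N' x' x'"
  shows "partial_iso m N N' (insert (x, x') Z)"
proof -
  have p': "anc N' p' x'"
    using x eqv_anc[OF N] e by blast
  have x': "\<not> same_side N' p' x' z'" if z': "z' \<in> Range Z" for z'
  proof -
    obtain z where z: "(z, z') \<in> Z"
      using z' by blast
    show ?thesis
      using x(4)[of z] z partial_iso_lft[OF p z] partial_iso_rgt[OF p z] eqv_atoms(3,4)[OF e(1)]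
      unfolding same_side_def by blast
  qed
  note 1 = N(1) partial_iso_meet_closed DomainI[OF p] x(3,4)
  note 2 = N(2) partial_iso_meet_closed' RangeI[OF p] p' x'
  show ?thesis
  proof (rule partial_iso_insert)
    show "meet_closed N (insert x (Domain Z))" "x \<notin> Domain Z" "x' \<notin> Range Z"
      using leaf_meet_closed[OF 1] leaf_notin[OF 1] leaf_notin[OF 2] by blast+
    fix z z'
    assume z: "(z, z') \<in> Z"
    have tr: "z = p \<longleftrightarrow> z' = p'" "lft N z p \<longleftrightarrow> lft N' z' p'" "rgt N z p \<longleftrightarrow> rgt N' z' p'"
      "lft N p x \<longleftrightarrow> lft N' p' x'" "rgt N p x \<longleftrightarrow> rgt N' p' x'"
      using partial_iso_eq[OF z p] partial_iso_lft[OF z p] partial_iso_rgt[OF z p]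
        eqv_atoms(3,4)[OF e(1)] by blast+
    show "(lft N z x \<longleftrightarrow> lft N' z' x') \<and> (rgt N z x \<longleftrightarrow> rgt N' z' x') \<and>
        (lft N x z \<longleftrightarrow> lft N' x' z') \<and> (rgt N x z \<longleftrightarrow> rgt N' x' z')"
      using leaf_below[OF 1 DomainI[OF z]] leaf_below[OF 2 RangeI[OF z]]
        anc_iff[OF N(1), of x z] anc_iff[OF N(2), of x' z']
      by (simp add: tr leaf_lft_above[OF 1 DomainI[OF z]] leaf_rgt_above[OF 1 DomainI[OF z]]
          leaf_lft_above[OF 2 RangeI[OF z]] leaf_rgt_above[OF 2 RangeI[OF z]])
    show "eqv m N z x N' z' x'" if "adjacent N (Domain Z) z x"
    proof -
      have "z = p"
        using that leaf_above[OF 1 DomainI[OF z]] p x unfolding adjacent_def by blast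
      then show ?thesis
        using e tr by blast
    qed
    show "eqv m N x z N' x' z'" if "adjacent N (Domain Z) x z"
      using that leaf_below[OF 1 DomainI[OF z]] unfolding adjacent_def by blast
  qed (use x e in auto)
qed

end

section \<open>Answering a prescribed position\<close>

lemma partial_iso_extend_leaf:
  assumes N: "nested_word N" "nested_word N'" and Z: "partial_iso (m + 2) N N' Z"
    and p: "p \<in> Domain Z"
    and x: "x \<in> nw_universe N" "anc N p x" "\<And>z. z \<in> Domain Z \<Longrightarrow> \<not> same_side N p x z"
  shows "\<exists>x'. partial_iso m N N' (insert (x, x') Z)"
proof -
  obtain p' where p': "(p, p') \<in> Z"
    using p by blast
  \<comment> \<open>Two levels are spent: one to place x by a round on the pair (p, p), the other to
    obtain the type of (x, x) from that of (p, x).\<close>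
  then have "eqv (Suc (Suc m)) N p p N' p' p'"
    using partial_iso_eqv[OF N Z] by simp
  then obtain x' where x': "x' \<in> nw_universe N'" "eqv (Suc m) N p x N' p' x'"
    using eqv_step x by blast
  have "partial_iso m N N' (insert (x, x') Z)"
    by (rule partial_iso_insert_leaf[OF N partial_iso_mono[OF Z] p' x(1) x'(1) x(2,3)])
      (use eqv_mono[OF x'(2), of m] eqv_diag[OF eqv_swap[OF x'(2)] x(1), of m] in auto)
  then show ?thesis
    by blast
qed

lemma partial_iso_extend_mid:
  assumes N: "nested_word N" "nested_word N'" and Z: "partial_iso (m + 2) N N' Z"
    and p: "p \<in> Domain Z" "q \<in> Domain Z" "adjacent N (Domain Z) p q"
    and x: "x \<in> nw_universe N" "anc N p x" "anc N x q"
  shows "\<exists>x'. partial_iso m N N' (insert (x, x') Z)"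
proof -
  obtain p' q' where p': "(p, p') \<in> Z" "(q, q') \<in> Z"
    using p by blast
  then have "eqv (Suc (Suc m)) N p q N' p' q'"
    using partial_iso_eqv_adjacent[OF N Z] p by simp
  then obtain x' where x': "x' \<in> nw_universe N'" "eqv (Suc m) N p x N' p' x'"
      "eqv (Suc m) N x q N' x' q'"
    using eqv_step x by blast
  have "partial_iso m N N' (insert (x, x') Z)"
    by (rule partial_iso_insert_mid[OF N partial_iso_mono[OF Z] p' p(3) x(1) x'(1) x(2,3)])
      (use eqv_mono[OF x'(2), of m] eqv_mono[OF x'(3), of m] eqv_diag[OF x'(3) x(1), of m] in auto)
  then show ?thesis
    by blast
qed

text \<open>A new position costs at most two insertions, a meet and then a leaf, of two levels
  each.\<close>

lemma partial_iso_extend: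
  assumes N: "nested_word N" "nested_word N'" and Z: "partial_iso (m + 4) N N' Z"
    and x: "x \<in> nw_universe N"
  shows "\<exists>Z' x'. Z \<subseteq> Z' \<and> (x, x') \<in> Z' \<and> partial_iso m N N' Z'"
proof (cases "x \<in> Domain Z")
  case True
  then show ?thesis
    using partial_iso_mono[OF Z, of m] by auto
next
  case False
  have Z4: "partial_iso (m + 2 + 2) N N' Z"
    using Z by (simp add: eval_nat_numeral)
  let ?S = "Domain Z"
  obtain \<rho> where \<rho>: "\<rho> \<in> ?S" "is_root N \<rho>"
    using partial_iso_root[OF N Z] by blast
  have "anc N \<rho> x"
    using root_anc[OF N(1) \<rho>(2) x] \<rho> False by blast
  \<comment> \<open>The ancestors of x form a chain that increases with position, so the greatest
    one in the domain is the deepest. It exists because the root is one and x bounds them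
    all.\<close>
  define p where "p = (GREATEST p. p \<in> ?S \<and> anc N p x)"
  have p: "p \<in> ?S" "anc N p x"
    unfolding p_def
    using GreatestI_nat[of "\<lambda>p. p \<in> ?S \<and> anc N p x" \<rho> x] \<rho> \<open>anc N \<rho> x\<close> anc_less less_imp_le by blast+
  have pmax: "z \<le> p" if "z \<in> ?S" "anc N z x" for z
    unfolding p_def
    using Greatest_le_nat[of "\<lambda>p. p \<in> ?S \<and> anc N p x" z x] that anc_less less_imp_le by blast
  show ?thesis
  proof (cases "\<exists>z\<in>?S. same_side N p x z")
    case False
    then have "\<exists>x'. partial_iso (m + 2) N N' (insert (x, x') Z)"
      using partial_iso_extend_leaf[OF N Z4 p(1) x p(2)] by blast
    then show ?thesis
      using partial_iso_mono[of "m + 2" _ _ _ m] by (meson insertI1 le_add1 subset_insertI)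
  next
    case True
    \<comment> \<open>A position of the domain strictly between p and q would be on the same side of
      p and smaller than q, so q is a neighbour of p.\<close>
    define q where "q = (LEAST z. z \<in> ?S \<and> same_side N p x z)"
    have q: "q \<in> ?S" "same_side N p x q"
      unfolding q_def using LeastI_ex[of "\<lambda>z. z \<in> ?S \<and> same_side N p x z"] True by blast+
    have qmin: "q \<le> z" if "z \<in> ?S" "same_side N p x z" for z
      unfolding q_def using Least_le[of "\<lambda>z. z \<in> ?S \<and> same_side N p x z"] that by blast
    have pq: "anc N p q"
      using q anc_iff[OF N(1)] unfolding same_side_def by blast
    have "False" if "z \<in> ?S" "anc N p z" "anc N z q" for z
    proof -
      have "same_side N p x z"
        using same_side_anc[OF N(1) that(2,3)] q(2) lft_not_rgt unfolding same_side_def by blast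
      then show False
        using qmin that anc_less by (meson leD)
    qed
    then have adj: "adjacent N ?S p q"
      using pq unfolding adjacent_def by blast
    have nqx: "\<not> anc N q x" "q \<noteq> x"
      using pmax q pq anc_less False by (meson leD, blast)
    show ?thesis
    proof (cases "anc N x q")
      case True
      then have "\<exists>x'. partial_iso (m + 2) N N' (insert (x, x') Z)"
        using partial_iso_extend_mid[OF N Z4 p(1) q(1) adj x p(2)] by blast
      then show ?thesis
        using partial_iso_mono[of "m + 2" _ _ _ m] by (meson insertI1 le_add1 subset_insertI)
    next
      case False
      \<comment> \<open>Now x branches off the path from p to q, and d is the branching point, in
        general outside the domain.\<close>
      obtain d where d: "d \<in> nw_universe N" "anc N d x" "anc N d q" "\<not> same_side N d x q"
        using ex_meet[OF N(1), of x q] ex_meet[OF N(1), of q x] False nqx anc_iff[OF N(1)] lft_not_rgt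
        unfolding same_side_def by (metis linorder_neqE_nat)
      \<comment> \<open>Were d above p, then x and q, both below p, would be on one side of d. Nor
        is d equal to p, since x and q share a side of p. So d is strictly between p and q.\<close>
      have "\<not> anc N d p"
        using same_side_anc[OF N(1) _ p(2), of d] same_side_anc[OF N(1) _ pq, of d] d(4) lft_not_rgt
        unfolding same_side_def by blast
      then have pd: "anc N p d"
        using anc_linear[OF p(2) d(2)] d(4) q(2) by blast
      obtain d' where Z1: "partial_iso (m + 2) N N' (insert (d, d') Z)" (is "partial_iso _ _ _ ?Z")
        using partial_iso_extend_mid[OF N Z4 p(1) q(1) adj d(1) pd d(3)] by blast
      \<comment> \<open>The old positions below d are q and its descendants, all on the other side
        than x. So x is a leaf below d.\<close>
      have "\<not> same_side N d x z" if z: "z \<in> Domain ?Z" for z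
      proof
        assume s: "same_side N d x z"
        then have dz: "anc N d z"
          using anc_iff[OF N(1)] unfolding same_side_def by blast
        then have "z \<in> ?S"
          using z anc_less by auto
        then have "z = q \<or> anc N q z"
          using mid_below[OF N(1) partial_iso_meet_closed[OF N Z] p(1) q(1) adj pd d(3)] dz by blast
        then have "same_side N d q z"
          using same_side_anc[OF N(1) d(3)] anc_iff[OF N(1)] d(3) unfolding same_side_def by blast
        then show False
          using s d(4) lft_not_rgt unfolding same_side_def by blast
      qed
      then obtain x' where "partial_iso m N N' (insert (x, x') ?Z)"
        using partial_iso_extend_leaf[OF N Z1 _ x d(2)] by blast
      then show ?thesis
        by (intro exI[of _ "insert (x, x') ?Z"] exI[of _ x']) auto
    qed
  qed
qed

text \<open>The ends of an edge are neighbours in every set of positions, since nothing in the whole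
  tree lies between them. So agreement on neighbouring pairs covers all edges.\<close>

lemma partial_iso_mu:
  assumes N: "nested_word N" "nested_word N'" and Z: "partial_iso m N N' Z"
    and xy: "(x, x') \<in> Z" "(y, y') \<in> Z"
  shows "nw_mu N x y \<longleftrightarrow> nw_mu N' x' y'"
proof -
  have adj: "adjacent M S u v" if "nested_word M" "nw_mu M u v" for M :: "'a nested_word" and S u v
    using mu_rgt[OF that] mu_adjacent[OF that] anc_iff[OF that(1)] unfolding adjacent_def by blast
  have "eqv m N x y N' x' y'" if "nw_mu N x y \<or> nw_mu N' x' y'"
    using adj N partial_iso_eqv_adjacent[OF N Z xy] partial_iso_adjacent[OF N Z xy] that by blast
  then show ?thesis
    using eqv_atoms(2) by blast
qed

section \<open>Preservation of satisfaction\<close>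

primrec qdepth :: "'a fo \<Rightarrow> nat" where
  "qdepth (Eq x y) = 0"
| "qdepth (Letter a x) = 0"
| "qdepth (Less x y) = 0"
| "qdepth (Mu x y) = 0"
| "qdepth (Call x) = 0"
| "qdepth (Ret x) = 0"
| "qdepth (Neg \<phi>) = qdepth \<phi>"
| "qdepth (Conj \<phi> \<psi>) = max (qdepth \<phi>) (qdepth \<psi>)"
| "qdepth (Disj \<phi> \<psi>) = max (qdepth \<phi>) (qdepth \<psi>)"
| "qdepth (Ex x \<phi>) = Suc (qdepth \<phi>)"
| "qdepth (All x \<phi>) = Suc (qdepth \<phi>)"

text \<open>Each quantifier consumes four levels. Only the variables of F other than x must be
  matched beforehand, because x is reassigned.\<close>

lemma partial_iso_forth:
  assumes N: "nested_word N" "nested_word N'" and Z: "partial_iso m N N' Z" "4 * Suc k \<le> m"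
    "\<forall>v\<in>F - {x}. (\<sigma> v, \<sigma>' v) \<in> Z" and i: "i \<in> nw_universe N"
  shows "\<exists>i'\<in>nw_universe N'. \<exists>Z'. partial_iso (4 * k) N N' Z' \<and>
    (\<forall>v\<in>F. ((\<sigma>(x := i)) v, (\<sigma>'(x := i')) v) \<in> Z')"
proof -
  have "partial_iso (4 * k + 4) N N' Z"
    using partial_iso_mono[OF Z(1)] Z(2) by simp
  then obtain Z' i' where Z': "Z \<subseteq> Z'" "(i, i') \<in> Z'" "partial_iso (4 * k) N N' Z'"
    using partial_iso_extend[OF N _ i] by blast
  then have "i' \<in> nw_universe N'"
    using partial_iso_universe[OF N] by blast
  then show ?thesis
    using Z' Z(3) by (intro bexI[of _ i'] exI[of _ Z']) auto
qed

lemma partial_iso_back: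
  assumes N: "nested_word N" "nested_word N'" and Z: "partial_iso m N N' Z" "4 * Suc k \<le> m"
    "\<forall>v\<in>F - {x}. (\<sigma> v, \<sigma>' v) \<in> Z" and i': "i' \<in> nw_universe N'"
  shows "\<exists>i\<in>nw_universe N. \<exists>Z'. partial_iso (4 * k) N N' Z' \<and>
    (\<forall>v\<in>F. ((\<sigma>(x := i)) v, (\<sigma>'(x := i')) v) \<in> Z')"
proof -
  obtain i Z' where "i \<in> nw_universe N" "partial_iso (4 * k) N' N Z'"
      "\<forall>v\<in>F. ((\<sigma>'(x := i')) v, (\<sigma>(x := i)) v) \<in> Z'"
    using partial_iso_forth[OF N(2,1) partial_iso_converse[OF N Z(1)] Z(2) _ i', of F x \<sigma>' \<sigma>] Z(3)
    by blast
  then show ?thesis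
    using partial_iso_converse[OF N(2,1)] by (intro bexI[of _ i] exI[of _ "Z'\<inverse>"]) auto
qed

lemma partial_iso_quantifier:
  assumes N: "nested_word N" "nested_word N'" and Z: "partial_iso m N N' Z"
      "4 * Suc (qdepth \<phi>) \<le> m" "\<forall>v\<in>free_vars \<phi> - {x}. (\<sigma> v, \<sigma>' v) \<in> Z"
    and IH: "\<And>m Z \<sigma> \<sigma>'. partial_iso m N N' Z \<Longrightarrow> 4 * qdepth \<phi> \<le> m \<Longrightarrow>
      (\<And>v. v \<in> free_vars \<phi> \<Longrightarrow> (\<sigma> v, \<sigma>' v) \<in> Z) \<Longrightarrow> sat N \<sigma> \<phi> \<longleftrightarrow> sat N' \<sigma>' \<phi>"
  shows "(\<exists>i\<in>nw_universe N. sat N (\<sigma>(x := i)) \<phi>) \<longleftrightarrow> (\<exists>i\<in>nw_universe N'. sat N' (\<sigma>'(x := i)) \<phi>)"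
    and "(\<forall>i\<in>nw_universe N. sat N (\<sigma>(x := i)) \<phi>) \<longleftrightarrow> (\<forall>i\<in>nw_universe N'. sat N' (\<sigma>'(x := i)) \<phi>)"
proof -
  have "\<exists>i'\<in>nw_universe N'. sat N (\<sigma>(x := i)) \<phi> \<longleftrightarrow> sat N' (\<sigma>'(x := i')) \<phi>"
    if i: "i \<in> nw_universe N" for i
  proof -
    obtain i' Z' where Z': "i' \<in> nw_universe N'" "partial_iso (4 * qdepth \<phi>) N N' Z'"
        "\<forall>v\<in>free_vars \<phi>. ((\<sigma>(x := i)) v, (\<sigma>'(x := i')) v) \<in> Z'"
      using partial_iso_forth[OF N Z i] by blast
    have "sat N (\<sigma>(x := i)) \<phi> \<longleftrightarrow> sat N' (\<sigma>'(x := i')) \<phi>"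
      by (rule IH[OF Z'(2) order_refl]) (use Z'(3) in blast)
    then show ?thesis
      using Z'(1) by blast
  qed
  moreover have "\<exists>i\<in>nw_universe N. sat N (\<sigma>(x := i)) \<phi> \<longleftrightarrow> sat N' (\<sigma>'(x := i')) \<phi>"
    if i': "i' \<in> nw_universe N'" for i'
  proof -
    obtain i Z' where Z': "i \<in> nw_universe N" "partial_iso (4 * qdepth \<phi>) N N' Z'"
        "\<forall>v\<in>free_vars \<phi>. ((\<sigma>(x := i)) v, (\<sigma>'(x := i')) v) \<in> Z'"
      using partial_iso_back[OF N Z i'] by blast
    have "sat N (\<sigma>(x := i)) \<phi> \<longleftrightarrow> sat N' (\<sigma>'(x := i')) \<phi>"
      by (rule IH[OF Z'(2) order_refl]) (use Z'(3) in blast)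
    then show ?thesis
      using Z'(1) by blast
  qed
  ultimately show "(\<exists>i\<in>nw_universe N. sat N (\<sigma>(x := i)) \<phi>) \<longleftrightarrow>
      (\<exists>i\<in>nw_universe N'. sat N' (\<sigma>'(x := i)) \<phi>)"
    and "(\<forall>i\<in>nw_universe N. sat N (\<sigma>(x := i)) \<phi>) \<longleftrightarrow> (\<forall>i\<in>nw_universe N'. sat N' (\<sigma>'(x := i)) \<phi>)"
    by meson+
qed

lemma partial_iso_sat:
  assumes N: "nested_word N" "nested_word N'"
    and Z: "partial_iso m N N' Z" "4 * qdepth \<phi> \<le> m" "\<And>v. v \<in> free_vars \<phi> \<Longrightarrow> (\<sigma> v, \<sigma>' v) \<in> Z"
  shows "sat N \<sigma> \<phi> \<longleftrightarrow> sat N' \<sigma>' \<phi>"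
  using Z
proof (induction \<phi> arbitrary: m Z \<sigma> \<sigma>')
  case (Eq x y)
  then show ?case
    using partial_iso_eq[OF N Eq(1)] by simp
next
  case (Letter a x)
  then show ?case
    using eqv_atoms(8)[OF partial_iso_eqv[OF N Letter(1)]] by simp
next
  case (Less x y)
  then show ?case
    using partial_iso_less[OF N Less(1)] by simp
next
  case (Mu x y)
  then show ?case
    using partial_iso_mu[OF N Mu(1)] by simp
next
  case (Call x)
  then show ?case
    using eqv_atoms(6)[OF partial_iso_eqv[OF N Call(1)]] by simp
next
  case (Ret x)
  then show ?case
    using eqv_atoms(7)[OF partial_iso_eqv[OF N Ret(1)]] by simp
next
  case (Neg \<phi>)
  then show ?case
    using Neg.IH[OF Neg.prems(1), of \<sigma> \<sigma>'] by simp
next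
  case (Conj \<phi> \<psi>)
  have "sat N \<sigma> \<phi> \<longleftrightarrow> sat N' \<sigma>' \<phi>" "sat N \<sigma> \<psi> \<longleftrightarrow> sat N' \<sigma>' \<psi>"
    by (rule Conj.IH[OF Conj.prems(1)]; use Conj.prems in \<open>simp add: nat_mult_max_right\<close>)+
  then show ?case
    by simp
next
  case (Disj \<phi> \<psi>)
  have "sat N \<sigma> \<phi> \<longleftrightarrow> sat N' \<sigma>' \<phi>" "sat N \<sigma> \<psi> \<longleftrightarrow> sat N' \<sigma>' \<psi>"
    by (rule Disj.IH[OF Disj.prems(1)]; use Disj.prems in \<open>simp add: nat_mult_max_right\<close>)+
  then show ?case
    by simp
next
  case (Ex x \<phi>)
  show ?case
    unfolding sat.simps
    by (rule partial_iso_quantifier(1)[OF N Ex.prems(1), of \<phi> x]; use Ex in simp)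
next
  case (All x \<phi>)
  show ?case
    unfolding sat.simps
    by (rule partial_iso_quantifier(2)[OF N All.prems(1), of \<phi> x]; use All in simp)
qed

section \<open>The initial position of the game\<close>

lemma partial_iso_start:
  assumes N: "nested_word N" "nested_word N'" and e: "eqv (m + 4) N a b N' a' b'"
    and U: "a \<in> nw_universe N" "b \<in> nw_universe N" "a' \<in> nw_universe N'" "b' \<in> nw_universe N'"
  shows "\<exists>Z. partial_iso m N N' Z \<and> (a, a') \<in> Z \<and> (b, b') \<in> Z"
proof -
  \<comment> \<open>This d is the upper one of a and b if they are comparable or equal, and their
    meet otherwise.\<close>
  obtain d where d: "d \<in> nw_universe N" "d = a \<or> anc N d a" "d = b \<or> anc N d b"
      "\<not> same_side N d a b"
  proof (cases "a = b \<or> anc N a b \<or> anc N b a")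
    case True
    then have "\<exists>d\<in>{a, b}. (d = a \<or> anc N d a) \<and> (d = b \<or> anc N d b)"
      by auto
    moreover have "\<not> same_side N a a b" "\<not> same_side N b a b"
      unfolding same_side_def lft_def rgt_def anc_def by auto
    ultimately show ?thesis
      using that U by blast
  next
    case False
    then show ?thesis
      using ex_meet[OF N(1), of a b] ex_meet[OF N(1), of b a] that anc_iff[OF N(1)] lft_not_rgt
      unfolding same_side_def by (metis linorder_neqE_nat)
  qed
  obtain \<rho> where \<rho>: "is_root N \<rho>"
    using ex_root U by blast
  then have \<rho>U: "\<rho> \<in> nw_universe N"
    by (simp add: is_root_def)
  \<comment> \<open>Two rounds find the partners: d' from the pair (a, b), then the partner of the
    root from the pair (a, d). Passing to single points costs one more level.\<close>
  have e4: "eqv (Suc (m + 3)) N a b N' a' b'"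
    using e by (simp add: eval_nat_numeral)
  obtain d' where d': "d' \<in> nw_universe N'" "eqv (m + 3) N a d N' a' d'" "eqv (m + 3) N d b N' d' b'"
    using eqv_step[OF e4 d(1)] by blast
  have e3: "eqv (Suc (m + 2)) N a d N' a' d'"
    using d'(2) by (simp add: eval_nat_numeral)
  obtain \<rho>' where \<rho>': "\<rho>' \<in> nw_universe N'" "eqv (m + 2) N \<rho> d N' \<rho>' d'"
    using eqv_step[OF e3 \<rho>U] by blast
  have eda: "eqv m N d a N' d' a'" "eqv m N d b N' d' b'" "eqv m N \<rho> d N' \<rho>' d'"
    using eqv_mono[OF eqv_swap[OF d'(2)], of m] eqv_mono[OF d'(3), of m] eqv_mono[OF \<rho>'(2), of m]
    by simp_all
  have diag: "eqv m N a a N' a' a'" "eqv m N b b N' b' b'" "eqv m N d d N' d' d'" "eqv m N \<rho> \<rho> N' \<rho>' \<rho>'"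
    using eqv_diag[OF e U(1), of m] eqv_diag[OF eqv_swap[OF e] U(2), of m]
      eqv_diag[OF d'(3) d(1), of m] eqv_diag[OF \<rho>'(2) \<rho>U, of m] by simp_all
  have irrefl: "\<not> lft M u u" "\<not> rgt M u u" "\<not> anc M u u" for M :: "'a nested_word" and u
    by (auto simp: lft_def rgt_def anc_def)
  define Z0 where "Z0 = {(\<rho>, \<rho>')}"
  have Z0: "partial_iso m N N' Z0"
    using \<rho> \<rho>U \<rho>' diag eqv_atoms(5)[OF \<rho>'(2)] irrefl
    unfolding partial_iso_def Z0_def meet_closed_def adjacent_def by auto
  \<comment> \<open>The set is built from the root downwards. Each of d, a and b is either already
    present or a leaf when it is added; for b after a this holds because d separates the
    two.\<close>
  define Z1 where "Z1 = insert (d, d') Z0"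
  have Z1: "partial_iso m N N' Z1"
  proof (cases "d = \<rho>")
    case True
    then show ?thesis
      using Z0 eqv_atoms(1)[OF \<rho>'(2)] unfolding Z1_def Z0_def by simp
  next
    case False
    show ?thesis
      unfolding Z1_def
      by (rule partial_iso_insert_leaf[OF N Z0 _ d(1) d'(1) root_anc[OF N(1) \<rho> d(1) False] _ eda(3) diag(3)])
        (auto simp: Z0_def same_side_def irrefl)
  qed
  define Z2 where "Z2 = insert (a, a') Z1"
  have nb: "\<not> lft N d \<rho>" "\<not> rgt N d \<rho>"
    using \<rho> d(1) unfolding is_root_def lft_def rgt_def anc_def by fastforce+
  have Z2: "partial_iso m N N' Z2"
  proof (cases "d = a")
    case True
    then show ?thesis
      using Z1 eqv_atoms(1)[OF eda(1)] unfolding Z2_def Z1_def by simp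
  next
    case False
    then have da: "anc N d a"
      using d by blast
    show ?thesis
      unfolding Z2_def
      by (rule partial_iso_insert_leaf[OF N Z1 _ U(1,3) da _ eda(1) diag(1)])
        (auto simp: Z1_def Z0_def same_side_def irrefl nb)
  qed
  have "partial_iso m N N' (insert (b, b') Z2)"
  proof (cases "d = b")
    case True
    then show ?thesis
      using Z2 eqv_atoms(1)[OF eda(2)] unfolding Z2_def Z1_def by (simp add: insert_commute)
  next
    case False
    then have db: "anc N d b"
      using d by blast
    show ?thesis
      by (rule partial_iso_insert_leaf[OF N Z2 _ U(2,4) db _ eda(2) diag(2)])
        (use d(4) in \<open>auto simp: Z2_def Z1_def Z0_def same_side_def irrefl nb\<close>)
  qed
  then show ?thesis
    unfolding Z2_def by blast
qed

section \<open>Reading a three-variable formula off the game\<close>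

lemma ex_three_variable_formula:
  fixes \<phi> :: "'a::finite fo"
  assumes V: "card V = 3" "x \<in> V" "y \<in> V" and \<phi>: "free_vars \<phi> \<subseteq> {x, y}"
  shows "\<exists>\<psi>. all_vars \<psi> \<subseteq> V \<and> free_vars \<psi> \<subseteq> {x, y} \<and>
    (\<forall>N \<sigma>. nested_word N \<longrightarrow> \<sigma> x \<in> nw_universe N \<longrightarrow> \<sigma> y \<in> nw_universe N \<longrightarrow>
       (sat N \<sigma> \<phi> \<longleftrightarrow> sat N \<sigma> \<psi>))"
proof -
  let ?k = "4 * qdepth \<phi>"
  let ?F = "rels (?k + 4) :: 'a binrel set"
  \<comment> \<open>\<A> collects the types realised by pairs that satisfy \<phi>, over all nested
    words. There are finitely many, so the disjunction of their patterns is definable.\<close>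
  define \<A> where "\<A> = {A \<in> Pow ?F. \<exists>N \<sigma>. nested_word N \<and> \<sigma> x \<in> nw_universe N \<and>
    \<sigma> y \<in> nw_universe N \<and> sat N \<sigma> \<phi> \<and> A = {R \<in> ?F. R N (\<sigma> x) (\<sigma> y)}}"
  define P where "P = (\<lambda>N a b. \<exists>A\<in>\<A>. pattern ?F A N a b)"
  have "fo_definable V P"
    unfolding P_def
    by (rule fo_definable_bex[OF _ fo_definable_pattern[OF finite_rels fo_definable_rels[OF V(1)]]])
      (simp_all add: \<A>_def finite_rels)
  then obtain \<psi> where \<psi>: "all_vars \<psi> \<subseteq> V" "defines_rel \<psi> x y P"
    using V unfolding fo_definable_def by blast
  have "sat N \<sigma> \<phi> \<longleftrightarrow> P N (\<sigma> x) (\<sigma> y)"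
    if N: "nested_word N" and U: "\<sigma> x \<in> nw_universe N" "\<sigma> y \<in> nw_universe N" for N \<sigma>
  proof
    assume "sat N \<sigma> \<phi>"
    then have "{R \<in> ?F. R N (\<sigma> x) (\<sigma> y)} \<in> \<A>"
      using N U unfolding \<A>_def by blast
    moreover have "pattern ?F {R \<in> ?F. R N (\<sigma> x) (\<sigma> y)} N (\<sigma> x) (\<sigma> y)"
      unfolding pattern_def by blast
    ultimately show "P N (\<sigma> x) (\<sigma> y)"
      unfolding P_def by blast
  next
    assume "P N (\<sigma> x) (\<sigma> y)"
    then obtain A where A: "A \<in> \<A>" "pattern ?F A N (\<sigma> x) (\<sigma> y)"
      unfolding P_def by blast
    obtain N' \<sigma>' where N': "nested_word N'" "\<sigma>' x \<in> nw_universe N'" "\<sigma>' y \<in> nw_universe N'"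
        "sat N' \<sigma>' \<phi>" "A = {R \<in> ?F. R N' (\<sigma>' x) (\<sigma>' y)}"
      using A(1) unfolding \<A>_def mem_Collect_eq by (elim conjE exE) (rule that)
    \<comment> \<open>A pair whose type lies in \<A> is indistinguishable from one that satisfies
      \<phi>, at a depth that suffices to transfer \<phi>.\<close>
    have "eqv (?k + 4) N (\<sigma> x) (\<sigma> y) N' (\<sigma>' x) (\<sigma>' y)"
      using A(2) N'(5) unfolding eqv_def pattern_def by blast
    then obtain Z where Z: "partial_iso ?k N N' Z" "(\<sigma> x, \<sigma>' x) \<in> Z" "(\<sigma> y, \<sigma>' y) \<in> Z"
      using partial_iso_start[OF N N'(1)] U N' by blast
    show "sat N \<sigma> \<phi>"
      using partial_iso_sat[OF N N'(1) Z(1), of \<phi> \<sigma> \<sigma>'] Z \<phi> N'(4) by blast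
  qed
  then show ?thesis
    using \<psi> unfolding defines_rel_def by (intro exI[of _ \<psi>]) simp
qed

section \<open>Sentences and the empty word\<close>

lemma sat_cong: "(\<And>v. v \<in> free_vars \<phi> \<Longrightarrow> \<sigma> v = \<sigma>' v) \<Longrightarrow> sat N \<sigma> \<phi> \<longleftrightarrow> sat N \<sigma>' \<phi>"
proof (induction \<phi> arbitrary: \<sigma> \<sigma>')
  case (Neg \<phi>)
  have "sat N \<sigma> \<phi> \<longleftrightarrow> sat N \<sigma>' \<phi>"
    by (rule Neg.IH) (use Neg.prems in simp)
  then show ?case
    by simp
next
  case (Conj \<phi> \<psi>)
  have "sat N \<sigma> \<phi> \<longleftrightarrow> sat N \<sigma>' \<phi>" "sat N \<sigma> \<psi> \<longleftrightarrow> sat N \<sigma>' \<psi>"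
    by (rule Conj.IH; use Conj.prems in simp)+
  then show ?case
    by simp
next
  case (Disj \<phi> \<psi>)
  have "sat N \<sigma> \<phi> \<longleftrightarrow> sat N \<sigma>' \<phi>" "sat N \<sigma> \<psi> \<longleftrightarrow> sat N \<sigma>' \<psi>"
    by (rule Disj.IH; use Disj.prems in simp)+
  then show ?case
    by simp
next
  case (Ex x \<phi>)
  have "sat N (\<sigma>(x := i)) \<phi> \<longleftrightarrow> sat N (\<sigma>'(x := i)) \<phi>" for i
    by (rule Ex.IH) (use Ex.prems in auto)
  then show ?case
    by simp
next
  case (All x \<phi>)
  have "sat N (\<sigma>(x := i)) \<phi> \<longleftrightarrow> sat N (\<sigma>'(x := i)) \<phi>" for i
    by (rule All.IH) (use All.prems in auto)
  then show ?case
    by simp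
qed simp_all

text \<open>A sentence is a Boolean combination of quantified formulas, and over an empty universe
  each quantifier has a fixed truth value.\<close>

lemma sat_empty_universe:
  assumes "free_vars \<phi> = {}" "nw_universe N = {}" "nw_universe N' = {}"
  shows "sat N \<sigma> \<phi> \<longleftrightarrow> sat N' \<sigma>' \<phi>"
  using assms by (induction \<phi>) auto

theorem theorem6p1:
  fixes \<phi> :: "'a::finite fo"
  assumes "card (free_vars \<phi>) \<le> 2"
  shows "\<exists>\<psi> :: 'a fo. free_vars \<psi> \<subseteq> free_vars \<phi> \<and> card (all_vars \<psi>) \<le> 3 \<and> fo_equiv \<phi> \<psi>"
proof -
  \<comment> \<open>Adding the three names 0, 1 and 2 ensures that a set V of exactly three names
    can be chosen around the free variables of \<phi>.\<close>
  have "card {..2::nat} \<le> card (free_vars \<phi> \<union> {..2})"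
    by (rule card_mono) auto
  then obtain V where V: "free_vars \<phi> \<subseteq> V" "card V = 3"
    using exists_subset_between[of "free_vars \<phi>" 3 "free_vars \<phi> \<union> {..2}"] assms by auto
  have fin: "finite V"
    using V(2) card.infinite by fastforce
  have card3: "card (all_vars \<psi>) \<le> 3" if "all_vars \<psi> \<subseteq> V" for \<psi> :: "'a fo"
    using card_mono[OF fin that] V(2) by simp
  show ?thesis
  proof (cases "free_vars \<phi> = {}")
    case False
    \<comment> \<open>A single free variable is covered by x = y.\<close>
    obtain x y where xy: "free_vars \<phi> = {x, y}"
    proof -
      have "card (free_vars \<phi>) = 1 \<or> card (free_vars \<phi>) = 2"
        using False assms by (metis One_nat_def card_0_eq finite_free_vars le_SucE le_zero_eq
            numeral_2_eq_2)
      then show ?thesis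
        using that by (metis card_1_singletonE card_2_iff insert_absorb2)
    qed
    obtain \<psi> where \<psi>: "all_vars \<psi> \<subseteq> V" "free_vars \<psi> \<subseteq> {x, y}"
        "\<forall>N \<sigma>. nested_word N \<longrightarrow> \<sigma> x \<in> nw_universe N \<longrightarrow> \<sigma> y \<in> nw_universe N \<longrightarrow>
          (sat N \<sigma> \<phi> \<longleftrightarrow> sat N \<sigma> \<psi>)"
      using ex_three_variable_formula[OF V(2), of x y \<phi>] V(1) xy by auto
    then have "fo_equiv \<phi> \<psi>" "free_vars \<psi> \<subseteq> free_vars \<phi>"
      using xy unfolding fo_equiv_def by auto
    then show ?thesis
      using card3 \<psi> by blast
  next
    case True
    obtain x where x: "x \<in> V"
      using V(2) by fastforce
    obtain \<psi> where \<psi>: "all_vars \<psi> \<subseteq> V" "free_vars \<psi> \<subseteq> {x}"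
        "\<forall>N \<sigma>. nested_word N \<longrightarrow> \<sigma> x \<in> nw_universe N \<longrightarrow> (sat N \<sigma> \<phi> \<longleftrightarrow> sat N \<sigma> \<psi>)"
      using ex_three_variable_formula[OF V(2) x x, of \<phi>] True by auto
    have nonempty: "sat N \<sigma> (Ex x \<psi>) \<longleftrightarrow> sat N \<sigma> \<phi>"
      if "nested_word N" "nw_universe N \<noteq> {}" for N \<sigma>
    proof -
      have "sat N (\<sigma>(x := i)) \<psi> \<longleftrightarrow> sat N \<sigma> \<phi>" if "i \<in> nw_universe N" for i
        using \<psi>(3) sat_cong[of \<phi> \<sigma> "\<sigma>(x := i)" N] True that \<open>nested_word N\<close> by simp
      then show ?thesis
        using that(2) by auto
    qed
    let ?E = "Fin_NW [] (\<lambda>_ _. False) (\<lambda>_. False) (\<lambda>_. False) :: 'a nested_word"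
    have empty: "sat N \<sigma> \<phi> \<longleftrightarrow> sat ?E (\<lambda>_. 0) \<phi>" if "nw_universe N = {}" for N \<sigma>
      using sat_empty_universe[OF True that, of ?E] by simp
    \<comment> \<open>On nonempty words \<phi> is equivalent to \<open>Ex x \<psi>\<close>, which is
      false on the empty word. If \<phi> holds there, a disjunct expressing emptiness is
      added.\<close>
    define \<chi> where "\<chi> = (if sat ?E (\<lambda>_. 0) \<phi> then Disj (Neg (Ex x (Eq x x))) (Ex x \<psi>) else Ex x \<psi>)"
    have "sat N \<sigma> \<phi> \<longleftrightarrow> sat N \<sigma> \<chi>" if "nested_word N" for N \<sigma>
      using nonempty[OF that] empty[of N \<sigma>] unfolding \<chi>_def by (cases "nw_universe N = {}") auto
    then have "fo_equiv \<phi> \<chi>"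
      unfolding fo_equiv_def by blast
    moreover have "free_vars \<chi> \<subseteq> {}" "all_vars \<chi> \<subseteq> V"
      using \<psi> x unfolding \<chi>_def by auto
    ultimately show ?thesis
      using card3 True by blast
  qed
qed

end
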